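(* Let $\lambda>0$, $c>0$, $0<p<1$, $q=1-p$. Let $(X(t),Y(t))$ be the planar random motion with direction process $D(t)$ defined in the context, and let $T(t)=\int_0^t\mathbf{1}_{\{D(\tau)\in\{d_1,d_3\}\}}\,d\tau$. Then for every $t>0$ $$\mathbb{P}\big(Y(t)=c\,T(t)\big)=\frac{e^{-\lambda t}}{8}\left\{\left(1+\frac{1}{\sqrt{2p(1-p)}}\right)^2e^{\lambda t\sqrt{2p(1-p)}}+\left(1-\frac{1}{\sqrt{2p(1-p)}}\right)^2e^{-\lambda t\sqrt{2p(1-p)}}-\frac{(2p-1)^2}{p(1-p)}\right\}.$$
   Context: Model. Let $d_j=(\cos(\pi j/2),\sin(\pi j/2))$, with index $j$ taken modulo 4. Let $N(t)$ be a homogeneous Poisson process of rate $\lambda$. The direction process $D(t)$ takes values in $\{d_0,d_1,d_2,d_3\}$; $D(0)$ is uniformly distributed and independent of $N$; $D$ is constant between Poisson events; at each Poisson event, independently of everything else, $D$ jumps from its current value $d_j$ to $d_{j+1}$ with probability $p$ (counterclockwise turn) and to $d_{j-1}$ with probability $q=1-p$ (clockwise turn); there is no reflection. The motion starts at the origin and has speed $c$: $(X(t),Y(t))=c\int_0^t D(\tau)\,d\tau$. *)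

theory Defs
  imports "HOL-Probability.Probability"
begin

text \<open>
  Time is the half-line \<open>t \<ge> 0\<close>; values of processes at negative times are irrelevant.
  Paths are required to be right-continuous and nondecreasing at every sample point; right-continuity
  refers to the discrete topology of the naturals. That almost surely all jumps have size one
  is a consequence and is not assumed.
\<close>

locale homogeneous_poisson_process = prob_space M for M :: "'a measure" +
  fixes N :: "real \<Rightarrow> 'a \<Rightarrow> nat" and rate :: real
  assumes rate_pos: "0 < rate"
    and N_measurable: "\<And>t. 0 \<le> t \<Longrightarrow> N t \<in> measurable M (count_space UNIV)"
    and N_0: "\<And>\<omega>. \<omega> \<in> space M \<Longrightarrow> N 0 \<omega> = 0"
    and N_mono: "\<And>\<omega> s t. \<omega> \<in> space M \<Longrightarrow> 0 \<le> s \<Longrightarrow> s \<le> t \<Longrightarrow> N s \<omega> \<le> N t \<omega>"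
    and N_right_continuous:
      "\<And>\<omega> t. \<omega> \<in> space M \<Longrightarrow> 0 \<le> t \<Longrightarrow> continuous (at_right t) (\<lambda>s. N s \<omega>)"
    and N_increment:
      "\<And>s t. 0 \<le> s \<Longrightarrow> s < t \<Longrightarrow>
         distr M (count_space UNIV) (\<lambda>\<omega>. N t \<omega> - N s \<omega>) = measure_pmf (poisson_pmf (rate * (t - s)))"
    and N_indep_increments:
      "\<And>(u :: nat \<Rightarrow> real) n. 0 \<le> u 0 \<Longrightarrow> (\<And>i. i < n \<Longrightarrow> u i < u (Suc i)) \<Longrightarrow>
         indep_vars (\<lambda>_. count_space UNIV) (\<lambda>i \<omega>. N (u (Suc i)) \<omega> - N (u i) \<omega>) {..<n}"

definition dir :: "int \<Rightarrow> real \<times> real" where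
  "dir j = (cos (pi * real_of_int j / 2), sin (pi * real_of_int j / 2))"

text \<open>
  \<open>turn n \<omega>\<close> is true iff the turn at Poisson event number \<open>n + 1\<close> is counterclockwise.
  The last assumption says that the initial direction, the whole sequence of turns and the
  whole Poisson process are mutually independent, through the sigma-algebras they generate.
\<close>

locale direction_process = homogeneous_poisson_process M N rate
  for M :: "'a measure" and N :: "real \<Rightarrow> 'a \<Rightarrow> nat" and rate :: real +
  fixes turn :: "nat \<Rightarrow> 'a \<Rightarrow> bool" and D :: "real \<Rightarrow> 'a \<Rightarrow> real \<times> real" and p :: real
  assumes p_prob: "0 \<le> p" "p \<le> 1"
    and D_measurable: "\<And>t. 0 \<le> t \<Longrightarrow> D t \<in> borel_measurable M"
    and D_values: "\<And>\<omega> t. \<omega> \<in> space M \<Longrightarrow> 0 \<le> t \<Longrightarrow> D t \<omega> \<in> {dir 0, dir 1, dir 2, dir 3}"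
    and D_0_uniform: "\<And>j. j \<in> {0, 1, 2, 3} \<Longrightarrow> prob {\<omega> \<in> space M. D 0 \<omega> = dir j} = 1 / 4"
    and D_constant_between_events:
      "\<And>\<omega> s t. \<omega> \<in> space M \<Longrightarrow> 0 \<le> s \<Longrightarrow> s \<le> t \<Longrightarrow> N t \<omega> = N s \<omega> \<Longrightarrow> D t \<omega> = D s \<omega>"
    and D_jump_at_event:
      "\<And>\<omega> s t j. \<omega> \<in> space M \<Longrightarrow> 0 \<le> s \<Longrightarrow> s \<le> t \<Longrightarrow> N t \<omega> = Suc (N s \<omega>) \<Longrightarrow> D s \<omega> = dir j \<Longrightarrow>
         D t \<omega> = (if turn (N s \<omega>) \<omega> then dir (j + 1) else dir (j - 1))"
    and turn_distr:
      "\<And>n. distr M (count_space UNIV) (turn n) = measure_pmf (bernoulli_pmf p)"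
    and turn_indep: "indep_vars (\<lambda>_. count_space UNIV) turn UNIV"
    and D_0_turns_N_indep:
      "indep_sets (\<lambda>i.
         [sets (vimage_algebra (space M) (D 0) borel),
          sets (vimage_algebra (space M) (\<lambda>\<omega> n. turn n \<omega>) (Pi\<^sub>M UNIV (\<lambda>_ :: nat. count_space UNIV))),
          sets (vimage_algebra (space M) (\<lambda>\<omega>. \<lambda>t\<in>{0..}. N t \<omega>)
            (Pi\<^sub>M {0..} (\<lambda>_ :: real. count_space UNIV)))] ! i) {..<3}"

definition position :: "real \<Rightarrow> (real \<Rightarrow> 'a \<Rightarrow> real \<times> real) \<Rightarrow> real \<Rightarrow> 'a \<Rightarrow> real \<times> real" where
  "position c D t \<omega> = c *\<^sub>R (LINT \<tau>:{0..t}|lborel. D \<tau> \<omega>)"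

definition vertical_time :: "(real \<Rightarrow> 'a \<Rightarrow> real \<times> real) \<Rightarrow> real \<Rightarrow> 'a \<Rightarrow> real" where
  "vertical_time D t \<omega> = (LINT \<tau>:{0..t}|lborel. indicator {dir 1, dir 3} (D \<tau> \<omega>))"

end

theory Submission
  imports Defs
begin

text \<open>
  The vertical component of \<open>D\<close> minus the indicator of vertical motion is \<open>-2\<close> times the indicator
  of direction \<open>dir 3\<close>, so the event says that direction \<open>dir 3\<close> is never taken before time \<open>t\<close>.
  Up to a null set this concerns only \<open>N t\<close> and the embedded walk on the 4-cycle. The walk killed
  at 3 satisfies a two-step recursion with factor \<open>2 * p * (1 - p)\<close>, and summing its survival
  probabilities against the Poisson weights gives the two exponentials.
\<close>

section \<open>Directions\<close>

lemma dir_0123 [simp]: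
  "dir 0 = (1, 0)" "dir 1 = (0, 1)" "dir 2 = (-1, 0)" "dir 3 = (0, -1)"
proof -
  have "pi * 3 / 2 = pi + pi / 2" by simp
  then have "cos (pi * 3 / 2) = 0" "sin (pi * 3 / 2) = -1"
    by (simp_all only: cos_add sin_add) simp_all
  then show "dir 0 = (1, 0)" "dir 1 = (0, 1)" "dir 2 = (-1, 0)" "dir 3 = (0, -1)"
    by (simp_all add: dir_def)
qed

lemma dir_mod_4: "dir (j mod 4) = dir j"
proof -
  have *: "pi * real_of_int j / 2 = pi * real_of_int (j mod 4) / 2 + real_of_int (j div 4) * (2 * pi)"
  proof -
    have "real_of_int j = 4 * real_of_int (j div 4) + real_of_int (j mod 4)"
      by (metis mult_div_mod_eq of_int_add of_int_mult of_int_numeral)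
    then show ?thesis by (simp add: field_simps)
  qed
  have "sin (real_of_int k * (2 * pi)) = 0" "cos (real_of_int k * (2 * pi)) = 1" for k :: int
    using sin_int_2pin[of k] cos_int_2pin[of k] by (simp_all add: mult.commute)
  then show ?thesis
    unfolding dir_def * by (simp add: cos_add sin_add)
qed

lemma dir_eq_dir_3_iff: "dir j = dir 3 \<longleftrightarrow> j mod 4 = 3"
proof -
  have "j mod 4 \<in> {0, 1, 2, 3}" by auto
  then show ?thesis
    by (subst dir_mod_4[symmetric]) auto
qed

section \<open>The walk on the 4-cycle killed at 3\<close>

text \<open>Positions are integers and are reduced modulo 4 only in the test; the starting position
  counts as visited. The head of the list is the first turn, so the recursion is a first-step
  decomposition.\<close>

fun avoids :: "int \<Rightarrow> bool list \<Rightarrow> bool" where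
  "avoids j [] \<longleftrightarrow> j mod 4 \<noteq> 3"
| "avoids j (b # bs) \<longleftrightarrow> j mod 4 \<noteq> 3 \<and> avoids (if b then j + 1 else j - 1) bs"

definition displacement :: "(nat \<Rightarrow> bool) \<Rightarrow> nat \<Rightarrow> int" where
  "displacement b k = (\<Sum>i<k. if b i then 1 else -1)"

lemma displacement_simps [simp]:
  "displacement b 0 = 0"
  "displacement b (Suc k) = displacement b k + (if b k then 1 else -1)"
  by (simp_all add: displacement_def)

lemma displacement_Suc_shift:
  "displacement b (Suc k) = (if b 0 then 1 else -1) + displacement (\<lambda>i. b (Suc i)) k"
  unfolding displacement_def by (subst sum.lessThan_Suc_shift) simp

lemma all_le_Suc_shift: "(\<forall>k\<le>Suc n. P k) \<longleftrightarrow> P 0 \<and> (\<forall>k\<le>n. P (Suc k))"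
  by (metis Suc_le_mono le0 not0_implies_Suc)

text \<open>Translates the first-step recursion into a condition on all partial sums. Peeling off
  \<open>b 0\<close> shifts both the starting point and the sequence, so the induction has to vary
  \<open>j\<close> and \<open>b\<close>.\<close>

lemma avoids_map_iff:
  "avoids j (map b [0..<n]) \<longleftrightarrow> (\<forall>k\<le>n. dir (j + displacement b k) \<noteq> dir 3)"
proof (induction n arbitrary: j b)
  case 0
  show ?case by (simp add: dir_eq_dir_3_iff del: dir_0123)
next
  case (Suc n)
  have "map b [0..<Suc n] = b 0 # map (\<lambda>i. b (Suc i)) [0..<n]"
    by (simp add: upt_conv_Cons map_Suc_upt[symmetric] del: upt_Suc)
  then show ?case
    by (simp add: Suc.IH all_le_Suc_shift displacement_Suc_shift dir_eq_dir_3_iff algebra_simps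
        del: dir_0123 displacement_simps(2) upt_Suc)
qed

text \<open>Probability that the walk from \<open>j\<close> stays off the class of 3 at times 0 to
  n, written as its backward equation.\<close>

fun survival :: "real \<Rightarrow> nat \<Rightarrow> int \<Rightarrow> real" where
  "survival p 0 j = of_bool (j mod 4 \<noteq> 3)"
| "survival p (Suc n) j =
     of_bool (j mod 4 \<noteq> 3) * (p * survival p n (j + 1) + (1 - p) * survival p n (j - 1))"

definition word_weight :: "real \<Rightarrow> bool list \<Rightarrow> real" where
  "word_weight p bs = (\<Prod>b\<leftarrow>bs. if b then p else 1 - p)"

lemma word_weight_Cons: "word_weight p (b # bs) = (if b then p else 1 - p) * word_weight p bs"
  by (simp add: word_weight_def)

lemma finite_bool_lists_length: "finite {bs :: bool list. length bs = n}"
  using finite_lists_length_eq[of "UNIV :: bool set" n] by simp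

text \<open>From an allowed \<open>j\<close>, the admissible words of length n + 1 split by their
  first letter into admissible words of length n from \<open>j + 1\<close> and from
  \<open>j - 1\<close>, which is exactly the recursion of \<open>survival\<close>.\<close>

lemma sum_word_weight_avoids:
  "(\<Sum>bs | length bs = n \<and> avoids j bs. word_weight p bs) = survival p n j"
proof (induction n arbitrary: j)
  case 0
  have "{bs. length bs = 0 \<and> avoids j bs} = (if j mod 4 \<noteq> 3 then {[]} else {})"
    by auto
  then show ?case by (simp add: word_weight_def)
next
  case (Suc n)
  show ?case
  proof (cases "j mod 4 = 3")
    case True
    have "{bs. length bs = Suc n \<and> avoids j bs} = {}"
      using True by (auto simp: length_Suc_conv)
    then have "(\<Sum>bs | length bs = Suc n \<and> avoids j bs. word_weight p bs) = 0"
      by (simp only: sum.empty)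
    then show ?thesis using True by simp
  next
    case False
    let ?A = "\<lambda>i. {bs. length bs = n \<and> avoids i bs}"
    have fin: "finite (?A i)" for i
      by (rule finite_subset[OF _ finite_bool_lists_length[of n]]) auto
    have "{bs. length bs = Suc n \<and> avoids j bs} = (#) True ` ?A (j + 1) \<union> (#) False ` ?A (j - 1)"
      using False by (auto simp: length_Suc_conv image_iff split: if_split_asm)
    then have "(\<Sum>bs | length bs = Suc n \<and> avoids j bs. word_weight p bs) =
        (\<Sum>bs\<in>(#) True ` ?A (j + 1). word_weight p bs) +
        (\<Sum>bs\<in>(#) False ` ?A (j - 1). word_weight p bs)"
      using fin by (simp only:) (subst sum.union_disjoint; auto)
    also have "\<dots> = p * survival p n (j + 1) + (1 - p) * survival p n (j - 1)"
      by (simp add: sum.reindex word_weight_Cons Suc.IH flip: sum_distrib_left)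
    finally show ?thesis using False by simp
  qed
qed

section \<open>Closed form of the survival probabilities and their Poisson mixture\<close>

lemma survival_cong_mod: "i mod 4 = j mod 4 \<Longrightarrow> survival p n i = survival p n j"
proof (induction n arbitrary: i j)
  case (Suc n)
  have "(i + 1) mod 4 = (j + 1) mod 4" "(i - 1) mod 4 = (j - 1) mod 4"
    using Suc.prems by (metis mod_add_left_eq, metis mod_diff_left_eq)
  then show ?case using Suc.prems Suc.IH by (metis survival.simps(2))
qed simp

lemma survival_3: "survival p n 3 = 0"
  by (cases n) simp_all

text \<open>Two steps from 1 that stay off 3 must return to 1, through 2 or through 0, each way with
  probability p(1 - p). Hence two steps multiply the survival probability by
  \<open>s\<^sup>2\<close>, and the solution is a combination of the n-th powers of s and -s; its
  coefficients are fitted to the value 1 at n = 0 and n = 1.\<close>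

lemma survival_1:
  assumes s: "s\<^sup>2 = 2 * p * (1 - p)" "s \<noteq> 0"
  shows "survival p n 1 = ((1 + 1 / s) * s ^ n + (1 - 1 / s) * (- s) ^ n) / 2"
proof (induction n rule: induct_nat_012)
  case (ge2 n)
  \<comment> \<open>The clockwise step from 0 lands on -1, which is the killed state 3.\<close>
  have "survival p n (- 1) = survival p n 3"
    by (rule survival_cong_mod) simp
  then have "survival p (Suc (Suc n)) 1 = s\<^sup>2 * survival p n 1"
    unfolding s by (simp add: survival_3 algebra_simps)
  also have "\<dots> = ((1 + 1 / s) * s ^ Suc (Suc n) + (1 - 1 / s) * (- s) ^ Suc (Suc n)) / 2"
    unfolding ge2(1) using s(2) by (simp add: power2_eq_square field_simps)
  finally show ?case .
qed (use s in \<open>simp_all add: field_simps\<close>)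

text \<open>For n > 0 a walk from 0 or 2 survives its first step only by moving to 1, with
  probability p or 1 - p; together the two starts contribute the survival probability from 1 after n
  - 1 steps. At n = 0 the true sum is 3 whereas the exponential part gives 1 + 1/s^2, hence the
  correction term.\<close>

lemma sum_survival:
  assumes s: "s\<^sup>2 = 2 * p * (1 - p)" "s \<noteq> 0"
  shows "(\<Sum>j\<in>{0, 1, 2, 3}. survival p n j) =
    ((1 + 1 / s)\<^sup>2 * s ^ n + (1 - 1 / s)\<^sup>2 * (- s) ^ n) / 2 + (2 - 1 / s\<^sup>2) * of_bool (n = 0)"
proof (cases n)
  case 0
  then show ?thesis
    using s(2) by (simp add: field_simps power2_eq_square)
next
  case (Suc m)
  have "survival p m (- 1) = survival p m 3"
    by (rule survival_cong_mod) simp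
  then have "(\<Sum>j\<in>{0, 1, 2, 3}. survival p n j) = survival p m 1 + survival p (Suc m) 1"
    unfolding Suc by (simp add: survival_3 algebra_simps)
  also have "\<dots> = ((1 + 1 / s)\<^sup>2 * s ^ n + (1 - 1 / s)\<^sup>2 * (- s) ^ n) / 2"
    unfolding survival_1[OF s] Suc using s(2) by (simp add: field_simps power2_eq_square)
  finally show ?thesis by (simp add: Suc)
qed

text \<open>Each geometric term turns into an exponential series; the correction at n = 0
  contributes only the constant inside the braces.\<close>

lemma sums_poisson_survival:
  assumes s: "s\<^sup>2 = 2 * p * (1 - p)" "s \<noteq> 0"
  shows "(\<lambda>n. x ^ n / fact n * exp (- x) * ((\<Sum>j\<in>{0, 1, 2, 3}. survival p n j) / 4)) sums
    (exp (- x) / 8 *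
      ((1 + 1 / s)\<^sup>2 * exp (x * s) + (1 - 1 / s)\<^sup>2 * exp (- x * s) + (4 - 2 / s\<^sup>2)))"
proof -
  have e: "(\<lambda>n. y ^ n / fact n) sums exp y" for y :: real
    using exp_converges[of y] by (simp add: divide_inverse mult.commute scaleR_conv_of_real)
  have "(\<lambda>n. exp (- x) / 8 * ((1 + 1 / s)\<^sup>2 * ((x * s) ^ n / fact n) +
      (1 - 1 / s)\<^sup>2 * ((- x * s) ^ n / fact n) + (4 - 2 / s\<^sup>2) * of_bool (n = 0))) sums
    (exp (- x) / 8 *
      ((1 + 1 / s)\<^sup>2 * exp (x * s) + (1 - 1 / s)\<^sup>2 * exp (- x * s) + (4 - 2 / s\<^sup>2) * 1))"
    using sums_single[of 0 "\<lambda>_. 1 :: real"]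
    by (intro sums_mult sums_add e) (simp add: of_bool_def)
  moreover have "exp (- x) / 8 * ((1 + 1 / s)\<^sup>2 * ((x * s) ^ n / fact n) +
      (1 - 1 / s)\<^sup>2 * ((- x * s) ^ n / fact n) + (4 - 2 / s\<^sup>2) * of_bool (n = 0)) =
      x ^ n / fact n * exp (- x) * ((\<Sum>j\<in>{0, 1, 2, 3}. survival p n j) / 4)" for n
  proof -
    have "(- x * s) ^ n = x ^ n * (- s) ^ n"
      by (metis mult_minus_left mult_minus_right power_mult_distrib)
    then show ?thesis
      unfolding sum_survival[OF s]
      by (cases "n = 0") (simp_all add: power_mult_distrib field_simps)
  qed
  ultimately show ?thesis by (simp only: mult_1_right)
qed

section \<open>Poisson increments\<close>

context homogeneous_poisson_process
begin

lemma prob_increment: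
  assumes "0 \<le> s" "s < t"
  shows "prob {\<omega> \<in> space M. N t \<omega> - N s \<omega> \<in> A} = measure (poisson_pmf (rate * (t - s))) A"
proof -
  have [measurable]: "N t \<in> measurable M (count_space UNIV)" "N s \<in> measurable M (count_space UNIV)"
    using N_measurable assms by auto
  have "measure (poisson_pmf (rate * (t - s))) A =
      measure (distr M (count_space UNIV) (\<lambda>\<omega>. N t \<omega> - N s \<omega>)) A"
    by (simp add: N_increment[OF assms])
  also have "\<dots> = prob ((\<lambda>\<omega>. N t \<omega> - N s \<omega>) -` A \<inter> space M)"
    by (rule measure_distr) auto
  also have "(\<lambda>\<omega>. N t \<omega> - N s \<omega>) -` A \<inter> space M = {\<omega> \<in> space M. N t \<omega> - N s \<omega> \<in> A}"
    by auto
  finally show ?thesis by simp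
qed

lemma prob_increment_ge_1:
  assumes "0 \<le> s" "s < t"
  shows "prob {\<omega> \<in> space M. N t \<omega> - N s \<omega> \<ge> 1} \<le> rate * (t - s)"
proof -
  let ?x = "rate * (t - s)"
  have x: "0 < ?x" using rate_pos assms by simp
  have *: "UNIV - {0} = {n :: nat. n \<ge> 1}" by auto
  have "prob {\<omega> \<in> space M. N t \<omega> - N s \<omega> \<ge> 1} = measure (poisson_pmf ?x) (UNIV - {0})"
    using prob_increment[OF assms, of "UNIV - {0}"] unfolding * mem_Collect_eq .
  also have "\<dots> = 1 - exp (- ?x)"
    using x by (subst measure_pmf.prob_compl[of "{0}", simplified]) (simp add: measure_pmf_single)
  also have "\<dots> \<le> ?x"
    using exp_ge_add_one_self[of "- ?x"] by linarith
  finally show ?thesis .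
qed

lemma prob_increment_ge_2:
  assumes "0 \<le> s" "s < t"
  shows "prob {\<omega> \<in> space M. N t \<omega> - N s \<omega> \<ge> 2} \<le> (rate * (t - s))\<^sup>2"
proof -
  let ?x = "rate * (t - s)"
  have x: "0 < ?x" using rate_pos assms by simp
  have *: "UNIV - {0, 1} = {n :: nat. n \<ge> 2}" by auto
  have "prob {\<omega> \<in> space M. N t \<omega> - N s \<omega> \<ge> 2} = measure (poisson_pmf ?x) (UNIV - {0, 1})"
    using prob_increment[OF assms, of "UNIV - {0, 1}"] unfolding * by simp
  also have "\<dots> = 1 - measure (poisson_pmf ?x) {0, 1}"
    using measure_pmf.prob_compl[of "{0, 1}" "poisson_pmf ?x"] by simp
  also have "\<dots> = 1 - exp (- ?x) * (1 + ?x)"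
    using x by (subst measure_measure_pmf_finite) (simp_all add: algebra_simps)
  also have "\<dots> \<le> ?x\<^sup>2"
    \<comment> \<open>The bound exp(-x) >= 1 - x, multiplied by 1 + x, gives exp(-x)(1 + x) >= 1 -
      x^2.\<close>
    using mult_right_mono[OF exp_ge_add_one_self[of "- ?x"], of "1 + ?x"] x
    by (simp add: algebra_simps power2_eq_square)
  finally show ?thesis .
qed

lemma prob_N:
  assumes "0 < t"
  shows "prob {\<omega> \<in> space M. N t \<omega> = n} = (rate * t) ^ n / fact n * exp (- (rate * t))"
proof -
  have "prob {\<omega> \<in> space M. N t \<omega> = n} = measure (poisson_pmf (rate * (t - 0))) {n}"
    using N_0 by (subst prob_increment[symmetric]) (use assms in \<open>auto intro!: arg_cong[where f = prob]\<close>)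
  then show ?thesis
    using assms rate_pos by (simp add: measure_pmf_single)
qed

text \<open>
  Along a grid with no double event in a cell, \<open>D\<close> follows the embedded walk. The empty last cell
  ensures that every value up to \<open>N t\<close> is attained strictly before \<open>t\<close>.
\<close>

definition good_grid :: "real \<Rightarrow> nat \<Rightarrow> 'a \<Rightarrow> bool" where
  "good_grid t m \<omega> \<longleftrightarrow>
     (\<forall>k\<le>m. N (real (Suc k) * (t / Suc m)) \<omega> - N (real k * (t / Suc m)) \<omega> < 2) \<and>
     N t \<omega> - N (real m * (t / Suc m)) \<omega> < 1"

lemma pred_good_grid:
  assumes "0 < t"
  shows "Measurable.pred M (good_grid t m)"
proof -
  have [measurable]: "N (real k * (t / Suc m)) \<in> measurable M (count_space UNIV)"
      "N t \<in> measurable M (count_space UNIV)" for k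
    using N_measurable assms by auto
  have A: "Measurable.pred M (\<lambda>\<omega>. N (real (Suc k) * (t / Suc m)) \<omega> - N (real k * (t / Suc m)) \<omega> < 2)" for k
    by measurable
  have B: "Measurable.pred M (\<lambda>\<omega>. N t \<omega> - N (real m * (t / Suc m)) \<omega> < 1)"
    by measurable
  show ?thesis unfolding good_grid_def[abs_def]
    by (intro pred_intros_logic(3,4) pred_intros_countable(1) A B measurable_const) simp
qed

text \<open>Union bound with cell length h = t/(m + 1): the m + 1 cells cost at most (rate h)^2 each
  for a double event, and the last cell costs at most rate h for any event. The total vanishes as
  the grid is refined.\<close>

lemma prob_not_good_grid:
  assumes "0 < t"
  shows "prob {\<omega> \<in> space M. \<not> good_grid t m \<omega>} \<le> ((rate * t)\<^sup>2 + rate * t) / Suc m"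
proof -
  define h where "h = t / Suc m"
  have h: "0 < h" "real (Suc m) * h = t" using assms by (simp_all add: h_def)
  have [measurable]: "N (real k * h) \<in> measurable M (count_space UNIV)"
      "N t \<in> measurable M (count_space UNIV)" for k
    using N_measurable assms h by auto
  let ?B = "\<lambda>k. {\<omega> \<in> space M. N (real (Suc k) * h) \<omega> - N (real k * h) \<omega> \<ge> 2}"
  let ?C = "{\<omega> \<in> space M. N (real (Suc m) * h) \<omega> - N (real m * h) \<omega> \<ge> 1}"
  have "{\<omega> \<in> space M. \<not> good_grid t m \<omega>} \<subseteq> (\<Union>k\<le>m. ?B k) \<union> ?C"
    unfolding good_grid_def h_def[symmetric] h(2)
    by (auto simp: not_less)
  then have "prob {\<omega> \<in> space M. \<not> good_grid t m \<omega>} \<le> prob ((\<Union>k\<le>m. ?B k) \<union> ?C)"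
    by (intro finite_measure_mono) (auto simp del: of_nat_Suc)
  also have "\<dots> \<le> prob (\<Union>k\<le>m. ?B k) + prob ?C"
    by (intro measure_Un_le) (auto simp del: of_nat_Suc)
  also have "prob (\<Union>k\<le>m. ?B k) \<le> (\<Sum>k\<le>m. prob (?B k))"
    by (intro measure_UNION_le) (auto simp del: of_nat_Suc)
  also have "\<dots> \<le> (\<Sum>k\<le>m. (rate * h)\<^sup>2)"
  proof (rule sum_mono)
    fix k
    show "prob (?B k) \<le> (rate * h)\<^sup>2"
      using prob_increment_ge_2[of "real k * h" "real (Suc k) * h"] h(1) by (simp add: algebra_simps)
  qed
  also have "prob ?C \<le> rate * h"
    using prob_increment_ge_1[of "real m * h" "real (Suc m) * h"] h(1) by (simp add: algebra_simps)
  also have "(\<Sum>k\<le>m. (rate * h)\<^sup>2) + rate * h = ((rate * t)\<^sup>2 + rate * t) / Suc m"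
  proof -
    have "n * (rate * (t / n))\<^sup>2 + rate * (t / n) = ((rate * t)\<^sup>2 + rate * t) / n"
      if "n \<noteq> 0" for n :: real
      using that by (simp add: field_simps power2_eq_square)
    from this[of "real (Suc m)"] show ?thesis
      unfolding h_def by (simp del: of_nat_Suc)
  qed
  finally show ?thesis by simp
qed

section \<open>Regularity of the counting path\<close>

lemma N_locally_constant_right:
  assumes "\<omega> \<in> space M" "0 \<le> s"
  obtains e where "s < e" "\<And>\<tau>. s \<le> \<tau> \<Longrightarrow> \<tau> < e \<Longrightarrow> N \<tau> \<omega> = N s \<omega>"
proof -
  have "((\<lambda>\<tau>. N \<tau> \<omega>) \<longlongrightarrow> N s \<omega>) (at_right s)"
    using N_right_continuous[OF assms] by (simp add: continuous_within)
  then have "eventually (\<lambda>\<tau>. N \<tau> \<omega> = N s \<omega>) (at_right s)"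
    by (simp add: tendsto_discrete)
  then obtain b where "s < b" "\<And>\<tau>. s < \<tau> \<Longrightarrow> \<tau> < b \<Longrightarrow> N \<tau> \<omega> = N s \<omega>"
    by (auto simp: eventually_at_right_field)
  then show ?thesis
    using that[of b] by (metis order_le_less)
qed

text \<open>A monotone real function is Borel. Clamping time with \<open>max 0\<close> avoids
  negative times, where nothing is known about the process.\<close>

lemma measurable_N_path:
  assumes "\<omega> \<in> space M"
  shows "(\<lambda>\<tau>. N (max 0 \<tau>) \<omega>) \<in> measurable borel (count_space UNIV)"
proof -
  have "mono (\<lambda>\<tau>. real (N (max 0 \<tau>) \<omega>))"
    using assms by (intro monoI) (simp add: N_mono)
  then have [measurable]: "(\<lambda>\<tau>. real (N (max 0 \<tau>) \<omega>)) \<in> borel_measurable borel"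
    by (rule borel_measurable_mono)
  have "(\<lambda>\<tau>. nat \<lfloor>real (N (max 0 \<tau>) \<omega>)\<rfloor>) \<in> measurable borel (count_space UNIV)"
    by measurable
  then show ?thesis by simp
qed

end

section \<open>Paths of the direction process\<close>

context direction_process
begin

lemma D_locally_constant_right:
  assumes "\<omega> \<in> space M" "0 \<le> s"
  obtains e where "s < e" "\<And>\<tau>. s \<le> \<tau> \<Longrightarrow> \<tau> < e \<Longrightarrow> D \<tau> \<omega> = D s \<omega>"
  using N_locally_constant_right[OF assms] D_constant_between_events[OF assms] by metis

text \<open>Along a path, \<open>D\<close> is constant on the level sets of \<open>N\<close>, so it
  is a function of the measurable counting path.\<close>

lemma measurable_D_path:
  assumes \<omega>: "\<omega> \<in> space M"
  shows "(\<lambda>\<tau>. D (max 0 \<tau>) \<omega>) \<in> borel_measurable borel"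
proof -
  \<comment> \<open>For a value n that the path never attains, \<open>g n\<close> is arbitrary, but
    it is never evaluated.\<close>
  define g where "g n = D (SOME s. 0 \<le> s \<and> N s \<omega> = n) \<omega>" for n
  have "D \<tau> \<omega> = g (N \<tau> \<omega>)" if "0 \<le> \<tau>" for \<tau>
  proof -
    let ?s = "SOME s. 0 \<le> s \<and> N s \<omega> = N \<tau> \<omega>"
    have "0 \<le> ?s \<and> N ?s \<omega> = N \<tau> \<omega>"
      using that by (intro someI[of "\<lambda>s. 0 \<le> s \<and> N s \<omega> = N \<tau> \<omega>" \<tau>]) simp
    then show ?thesis
      unfolding g_def using D_constant_between_events[OF \<omega>] that by (metis linear)
  qed
  then have "(\<lambda>\<tau>. D (max 0 \<tau>) \<omega>) = (\<lambda>\<tau>. g (N (max 0 \<tau>) \<omega>))" by auto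
  also have "\<dots> \<in> borel_measurable borel"
    using measurable_compose[OF measurable_N_path[OF \<omega>], of g borel] by simp
  finally show ?thesis .
qed

text \<open>The two sides of the equation differ by -2c times the Lebesgue measure of the time spent
  in \<open>dir 3\<close>. A visit before t lasts for an interval of positive length, while a visit
  at t alone has measure zero; this is why the interval is half-open.\<close>

lemma snd_position_eq_iff:
  assumes \<omega>: "\<omega> \<in> space M" and t: "0 < t" and c: "c \<noteq> 0"
  shows "snd (position c D t \<omega>) = c * vertical_time D t \<omega> \<longleftrightarrow> (\<forall>\<tau>\<in>{0..<t}. D \<tau> \<omega> \<noteq> dir 3)"
proof -
  define S where "S = {\<tau> \<in> {0..t}. D \<tau> \<omega> = dir 3}"
  define F where "F \<tau> = indicator {0..t} \<tau> *\<^sub>R D \<tau> \<omega>" for \<tau>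
  define V where "V \<tau> = indicator {0..t} \<tau> *\<^sub>R (indicator {dir 1, dir 3} (D \<tau> \<omega>) :: real)" for \<tau>
  note [measurable] = measurable_D_path[OF \<omega>]
  have "F = (\<lambda>\<tau>. indicator {0..t} \<tau> *\<^sub>R D (max 0 \<tau>) \<omega>)"
    by (auto simp: F_def indicator_def)
  then have [measurable]: "F \<in> borel_measurable borel" by simp
  have "V = (\<lambda>\<tau>. indicator {0..t} \<tau> *\<^sub>R indicator {dir 1, dir 3} (D (max 0 \<tau>) \<omega>))"
    by (auto simp: V_def indicator_def)
  then have [measurable]: "V \<in> borel_measurable borel" by simp
  have "S = {0..t} \<inter> {\<tau>. D (max 0 \<tau>) \<omega> = dir 3}" by (auto simp: S_def)
  also have "\<dots> \<in> sets borel" by measurable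
  finally have S [measurable]: "S \<in> sets borel" .
  have S_fin: "emeasure lborel S < \<infinity>"
  proof -
    have "emeasure lborel S \<le> emeasure lborel {0..t}"
      by (rule emeasure_mono) (auto simp: S_def)
    also have "\<dots> < \<infinity>" using t by simp
    finally show ?thesis .
  qed
  have bound: "integrable lborel (\<lambda>\<tau>. indicator {0..t} \<tau> * (1 :: real))"
    using t by simp
  have D_cases: "D \<tau> \<omega> \<in> {(1, 0), (0, 1), (-1, 0), (0, -1)}" if "0 \<le> \<tau>" for \<tau>
    using D_values[OF \<omega> that] by simp
  have int_F: "integrable lborel F"
    by (rule Bochner_Integration.integrable_bound[OF bound])
      (use D_cases in \<open>fastforce simp: F_def indicator_def norm_Pair\<close>)+
  have int_V: "integrable lborel V"
    by (rule Bochner_Integration.integrable_bound[OF bound])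
      (auto simp: V_def indicator_def)
  \<comment> \<open>In the order of \<open>D_cases\<close>, the difference inside the time window is
    0, 0, 0, -2.\<close>
  have diff: "snd (F \<tau>) - V \<tau> = - 2 * indicator S \<tau>" for \<tau>
    using D_cases[of \<tau>] by (auto simp: F_def V_def S_def indicator_def)
  have "snd (position c D t \<omega>) - c * vertical_time D t \<omega> =
      c * (snd (integral\<^sup>L lborel F) - integral\<^sup>L lborel V)"
    unfolding position_def vertical_time_def set_lebesgue_integral_def F_def[abs_def] V_def[abs_def]
    by (simp add: algebra_simps)
  also have "snd (integral\<^sup>L lborel F) = (LINT \<tau>|lborel. snd (F \<tau>))"
    using integral_bounded_linear[OF bounded_linear_snd int_F] by simp
  also have "\<dots> - integral\<^sup>L lborel V = (LINT \<tau>|lborel. snd (F \<tau>) - V \<tau>)"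
    using integrable_bounded_linear[OF bounded_linear_snd int_F] int_V
    by (rule Bochner_Integration.integral_diff[symmetric])
  also have "\<dots> = - 2 * measure lborel S"
    unfolding diff using S_fin by simp
  finally have "snd (position c D t \<omega>) = c * vertical_time D t \<omega> \<longleftrightarrow> measure lborel S = 0"
    using c by (smt (verit) mult_eq_0_iff)
  also have "\<dots> \<longleftrightarrow> (\<forall>\<tau>\<in>{0..<t}. D \<tau> \<omega> \<noteq> dir 3)"
  proof
    assume S0: "measure lborel S = 0"
    show "\<forall>\<tau>\<in>{0..<t}. D \<tau> \<omega> \<noteq> dir 3"
    proof (intro ballI notI)
      fix s assume s: "s \<in> {0..<t}" "D s \<omega> = dir 3"
      obtain e where e: "s < e" "\<And>\<tau>. s \<le> \<tau> \<Longrightarrow> \<tau> < e \<Longrightarrow> D \<tau> \<omega> = D s \<omega>"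
        using D_locally_constant_right[OF \<omega>, of s] s by auto
      have "{s..<min e t} \<subseteq> S" using e s by (auto simp: S_def)
      then have "measure lborel {s..<min e t} \<le> measure lborel S"
        using S_fin by (intro measure_mono_fmeasurable) (auto simp: fmeasurable_def)
      then show False using S0 s e(1) by (auto simp: min_def split: if_splits)
    qed
  next
    assume avoid: "\<forall>\<tau>\<in>{0..<t}. D \<tau> \<omega> \<noteq> dir 3"
    have "\<tau> = t" if "\<tau> \<in> S" for \<tau>
      using that avoid by (fastforce simp: S_def)
    then have "S = {} \<or> S = {t}" by blast
    then show "measure lborel S = 0" by auto
  qed
  finally show ?thesis .
qed

text \<open>Right-continuity makes every visit to \<open>dir 3\<close> before t visible at a
  rational time before t, so the uncountable quantifier becomes countable.\<close>

lemma pred_avoids_path: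
  "Measurable.pred M (\<lambda>\<omega>. \<forall>\<tau>\<in>{0..<t}. D \<tau> \<omega> \<noteq> dir 3)"
proof -
  have eq: "(\<forall>\<tau>\<in>{0..<t}. D \<tau> \<omega> \<noteq> dir 3) \<longleftrightarrow>
      (\<forall>q :: rat. of_rat q \<in> {0..<t} \<longrightarrow> D (of_rat q) \<omega> \<noteq> dir 3)"
    if \<omega>: "\<omega> \<in> space M" for \<omega>
  proof (intro iffI ballI)
    fix s assume rat: "\<forall>q :: rat. of_rat q \<in> {0..<t} \<longrightarrow> D (of_rat q) \<omega> \<noteq> dir 3" and s: "s \<in> {0..<t}"
    obtain e where e: "s < e" "\<And>\<tau>. s \<le> \<tau> \<Longrightarrow> \<tau> < e \<Longrightarrow> D \<tau> \<omega> = D s \<omega>"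
      using D_locally_constant_right[OF \<omega>, of s] s by auto
    obtain q :: rat where q: "s < real_of_rat q" "real_of_rat q < min e t"
      using of_rat_dense[of s "min e t"] e(1) s by auto
    then have "real_of_rat q \<in> {0..<t}"
      using s unfolding atLeastLessThan_iff by linarith
    moreover have "D (of_rat q) \<omega> = D s \<omega>"
      using q by (intro e(2)) linarith+
    ultimately show "D s \<omega> \<noteq> dir 3" using rat by metis
  qed auto
  have pred: "Measurable.pred M (\<lambda>\<omega>. \<forall>q :: rat. of_rat q \<in> {0..<t} \<longrightarrow> D (of_rat q) \<omega> \<noteq> dir 3)"
  proof (intro pred_intros_countable(1))
    fix q :: rat
    show "Measurable.pred M (\<lambda>\<omega>. of_rat q \<in> {0..<t} \<longrightarrow> D (of_rat q) \<omega> \<noteq> dir 3)"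
    proof (cases "of_rat q \<in> {0..<t}")
      case True
      then have [measurable]: "D (of_rat q) \<in> borel_measurable M" using D_measurable by auto
      show ?thesis unfolding pred_def by measurable
    next
      case False
      then show ?thesis by (simp only: simp_thms) (rule measurable_const, simp)
    qed
  qed
  show ?thesis
    by (rule iffD2[OF measurable_cong[OF eq] pred])
qed

section \<open>Comparison of the path with the embedded walk\<close>

text \<open>The jump rule of \<open>D\<close> speaks only of increments by one. In a cell with fewer
  than two events, \<open>N\<close> either keeps its value at the left end or exceeds it by one, so
  an induction over cells carries the formula along and shows that \<open>N\<close> skips no
  value.\<close>

lemma D_eq_dir_displacement:
  assumes \<omega>: "\<omega> \<in> space M" and h: "0 \<le> h" and j: "D 0 \<omega> = dir j"
    and cells: "\<And>i. i < k \<Longrightarrow> N (real (Suc i) * h) \<omega> - N (real i * h) \<omega> < 2"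
  shows "(\<forall>\<tau>\<in>{0..real k * h}. D \<tau> \<omega> = dir (j + displacement (\<lambda>i. turn i \<omega>) (N \<tau> \<omega>))) \<and>
    (\<forall>n\<le>N (real k * h) \<omega>. \<exists>\<tau>\<in>{0..real k * h}. N \<tau> \<omega> = n)"
  using cells
proof (induction k)
  case 0
  then show ?case using \<omega> j by (auto simp: N_0)
next
  case (Suc k)
  let ?a = "real k * h" and ?b = "real (Suc k) * h" and ?w = "\<lambda>i. turn i \<omega>"
  have ab: "0 \<le> ?a" "?a \<le> ?b" using h by (auto intro: mult_right_mono)
  have D: "D \<tau> \<omega> = dir (j + displacement ?w (N \<tau> \<omega>))" if "\<tau> \<in> {0..?a}" for \<tau>
    using Suc that by auto
  have step: "N \<tau> \<omega> = N ?a \<omega> \<or> N \<tau> \<omega> = Suc (N ?a \<omega>)" if "\<tau> \<in> {?a..?b}" for \<tau>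
    using N_mono[OF \<omega>, of ?a \<tau>] N_mono[OF \<omega>, of \<tau> ?b] Suc.prems[of k] that ab by fastforce
  have "D \<tau> \<omega> = dir (j + displacement ?w (N \<tau> \<omega>))" if \<tau>: "\<tau> \<in> {0..?b}" for \<tau>
  proof (cases "\<tau> \<le> ?a")
    case False
    have Da: "D ?a \<omega> = dir (j + displacement ?w (N ?a \<omega>))"
      using D[of ?a] ab by simp
    consider "N \<tau> \<omega> = N ?a \<omega>" | "N \<tau> \<omega> = Suc (N ?a \<omega>)"
      using step[of \<tau>] False \<tau> by auto
    then show ?thesis
    proof cases
      case 1
      then show ?thesis
        using D_constant_between_events[OF \<omega>, of ?a \<tau>] Da ab False by simp
    next
      case 2
      then show ?thesis
        using D_jump_at_event[OF \<omega>, of ?a \<tau>, OF _ _ 2 Da] ab False by (simp add: algebra_simps)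
    qed
  qed (use D \<tau> in auto)
  moreover have "\<exists>\<tau>\<in>{0..?b}. N \<tau> \<omega> = n" if n: "n \<le> N ?b \<omega>" for n
  proof (cases "n \<le> N ?a \<omega>")
    case True
    then obtain \<tau> where "\<tau> \<in> {0..?a}" "N \<tau> \<omega> = n" using Suc by auto
    then show ?thesis using ab by (intro bexI[of _ \<tau>]) auto
  next
    case False
    then have "N ?b \<omega> = n" using step[of ?b] n ab by auto
    then show ?thesis using ab by (intro bexI[of _ ?b]) auto
  qed
  ultimately show ?case by blast
qed

text \<open>Phrased through \<open>D 0\<close>, \<open>N t\<close> and the turns only, the three
  independent ingredients of the model.\<close>

definition walk_avoids :: "real \<Rightarrow> 'a \<Rightarrow> bool" where
  "walk_avoids t \<omega> \<longleftrightarrow>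
    (\<exists>j\<in>{0, 1, 2, 3}. D 0 \<omega> = dir j \<and> avoids j (map (\<lambda>i. turn i \<omega>) [0..<N t \<omega>]))"

lemma dir_inj_on: "inj_on dir {0, 1, 2, 3}"
  by (auto simp: inj_on_def)

lemma walk_avoids_iff:
  assumes \<omega>: "\<omega> \<in> space M" and t: "0 < t" and good: "good_grid t m \<omega>"
  shows "walk_avoids t \<omega> \<longleftrightarrow> (\<forall>\<tau>\<in>{0..<t}. D \<tau> \<omega> \<noteq> dir 3)"
proof -
  define h where "h = t / Suc m"
  have h: "0 < h" "real (Suc m) * h = t" using t by (simp_all add: h_def)
  then have mh: "0 \<le> real m * h" "real m * h < t" by (simp_all flip: h(2) add: algebra_simps)
  have cells: "N (real (Suc i) * h) \<omega> - N (real i * h) \<omega> < 2" if "i \<le> m" for i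
    using good that unfolding good_grid_def h_def by blast
  \<comment> \<open>Subtraction on naturals is truncated; monotonicity of \<open>N\<close> is what
    turns the empty last cell into equality.\<close>
  have last: "N t \<omega> = N (real m * h) \<omega>"
    using good N_mono[OF \<omega>, of "real m * h" t] mh unfolding good_grid_def h_def by auto
  obtain j where j: "j \<in> {0, 1, 2, 3}" "D 0 \<omega> = dir j"
    using D_values[OF \<omega>, of 0] by blast
  let ?w = "\<lambda>i. turn i \<omega>"
  \<comment> \<open>Injectivity of \<open>dir\<close> on the four indices collapses the existential
    to the one starting index.\<close>
  have "walk_avoids t \<omega> \<longleftrightarrow> avoids j (map ?w [0..<N t \<omega>])"
    unfolding walk_avoids_def j(2) using j(1) dir_inj_on by (metis inj_on_eq_iff)
  also have "\<dots> \<longleftrightarrow> (\<forall>n\<le>N t \<omega>. dir (j + displacement ?w n) \<noteq> dir 3)"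
    by (rule avoids_map_iff)
  also have "\<dots> \<longleftrightarrow> (\<forall>\<tau>\<in>{0..<t}. D \<tau> \<omega> \<noteq> dir 3)"
  proof -
    have D: "\<forall>\<tau>\<in>{0..t}. D \<tau> \<omega> = dir (j + displacement ?w (N \<tau> \<omega>))"
      using D_eq_dir_displacement[OF \<omega> less_imp_le[OF h(1)] j(2), of "Suc m"] cells
      unfolding h(2) by (meson less_Suc_eq_le)
    \<comment> \<open>Only the first m cells are used here, so the attaining times are at most
      \<open>real m * h\<close>, hence strictly before t.\<close>
    have hit: "\<forall>n\<le>N t \<omega>. \<exists>\<tau>\<in>{0..real m * h}. N \<tau> \<omega> = n"
      using D_eq_dir_displacement[OF \<omega> less_imp_le[OF h(1)] j(2), of m] cells
      unfolding last by (meson less_imp_le)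
    show ?thesis
    proof (intro iffI ballI allI impI)
      fix \<tau> assume "\<forall>n\<le>N t \<omega>. dir (j + displacement ?w n) \<noteq> dir 3" "\<tau> \<in> {0..<t}"
      then show "D \<tau> \<omega> \<noteq> dir 3" using D N_mono[OF \<omega>, of \<tau> t] by auto
    next
      fix n assume avoid: "\<forall>\<tau>\<in>{0..<t}. D \<tau> \<omega> \<noteq> dir 3" and n: "n \<le> N t \<omega>"
      obtain \<tau> where \<tau>: "\<tau> \<in> {0..real m * h}" "N \<tau> \<omega> = n" using hit n by blast
      then have "\<tau> \<in> {0..<t}" "\<tau> \<in> {0..t}" using mh by auto
      then show "dir (j + displacement ?w n) \<noteq> dir 3" using D avoid \<tau> by metis
    qed
  qed
  finally show ?thesis .
qed

section \<open>Law of the embedded walk\<close>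

lemma measurable_turn [measurable]: "turn n \<in> measurable M (count_space UNIV)"
  using turn_indep by (auto simp: indep_vars_def)

lemma measurable_D_0 [measurable]: "D 0 \<in> borel_measurable M"
  by (rule D_measurable) simp

lemma prob_turn: "prob (turn n -` {b} \<inter> space M) = (if b then p else 1 - p)"
proof -
  have "prob (turn n -` {b} \<inter> space M) = measure (distr M (count_space UNIV) (turn n)) {b}"
    by (rule measure_distr[symmetric]) auto
  also have "\<dots> = pmf (bernoulli_pmf p) b"
    by (simp add: turn_distr measure_pmf_single)
  finally show ?thesis using p_prob by simp
qed

lemma prob_turns:
  assumes "length bs = n"
  shows "prob {\<omega> \<in> space M. map (\<lambda>i. turn i \<omega>) [0..<n] = bs} = word_weight p bs"
\<comment> \<open>The empty word is separate: an intersection over no indices would be the whole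
  type, not \<open>space M\<close>.\<close>
proof (cases "n = 0")
  case True
  then show ?thesis using assms prob_space by (simp add: word_weight_def)
next
  case False
  have "{\<omega> \<in> space M. map (\<lambda>i. turn i \<omega>) [0..<n] = bs} =
      (\<Inter>i\<in>{..<n}. turn i -` {bs ! i} \<inter> space M)"
    using False assms by (auto simp: list_eq_iff_nth_eq)
  also have "prob \<dots> = (\<Prod>i<n. prob (turn i -` {bs ! i} \<inter> space M))"
    using False by (intro indep_varsD[OF turn_indep]) auto
  also have "\<dots> = word_weight p bs"
    using assms by (simp add: prob_turn word_weight_def prod.list_conv_set_nth atLeast0LessThan)
  finally show ?thesis .
qed

text \<open>The three conditions lie in the sigma-algebras generated by the initial direction, the
  Poisson process and the turn sequence; the latter two are cylinder sets depending on finitely many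
  coordinates. Independence gives the product.\<close>

lemma prob_D0_N_turns:
  assumes t: "0 < t" and j: "j \<in> {0, 1, 2, 3}" and bs: "length bs = n"
  shows "prob {\<omega> \<in> space M. D 0 \<omega> = dir j \<and> N t \<omega> = n \<and> map (\<lambda>i. turn i \<omega>) [0..<n] = bs} =
    1 / 4 * ((rate * t) ^ n / fact n * exp (- (rate * t))) * word_weight p bs"
proof -
  let ?A = "{\<omega> \<in> space M. D 0 \<omega> = dir j}"
  let ?B = "{\<omega> \<in> space M. map (\<lambda>i. turn i \<omega>) [0..<n] = bs}"
  let ?C = "{\<omega> \<in> space M. N t \<omega> = n}"
  let ?PB = "Pi\<^sub>M UNIV (\<lambda>_ :: nat. count_space (UNIV :: bool set))"
  let ?PC = "Pi\<^sub>M {0..} (\<lambda>_ :: real. count_space (UNIV :: nat set))"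
  have A: "?A \<in> sets (vimage_algebra (space M) (D 0) borel)"
  proof -
    have "?A = D 0 -` {dir j} \<inter> space M" by auto
    then show ?thesis by (simp add: in_vimage_algebra)
  qed
  have B: "?B \<in> sets (vimage_algebra (space M) (\<lambda>\<omega> n. turn n \<omega>) ?PB)"
  proof -
    have "{f \<in> space ?PB. \<forall>i<n. f i = bs ! i} \<in> sets ?PB" by measurable
    moreover have "?B = (\<lambda>\<omega> n. turn n \<omega>) -` {f \<in> space ?PB. \<forall>i<n. f i = bs ! i} \<inter> space M"
      using bs by (auto simp: space_PiM list_eq_iff_nth_eq)
    ultimately show ?thesis by (simp only: in_vimage_algebra)
  qed
  have C: "?C \<in> sets (vimage_algebra (space M) (\<lambda>\<omega>. \<lambda>t\<in>{0..}. N t \<omega>) ?PC)"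
  proof -
    have "t \<in> {0..}" using t by simp
    then have [measurable]: "(\<lambda>f. f t) \<in> measurable ?PC (count_space UNIV)"
      by (rule measurable_component_singleton)
    have "{f \<in> space ?PC. f t = n} \<in> sets ?PC" by measurable
    moreover have "?C = (\<lambda>\<omega>. \<lambda>t\<in>{0..}. N t \<omega>) -` {f \<in> space ?PC. f t = n} \<inter> space M"
      using t by (auto simp: space_PiM)
    ultimately show ?thesis by (simp only: in_vimage_algebra)
  qed
  define E where "E i = [?A, ?B, ?C] ! i" for i
  have three: "{..<3::nat} = {0, 1, 2}" by auto
  have "prob (\<Inter>i\<in>{..<3}. E i) = (\<Prod>i<3. prob (E i))"
    by (rule indep_setsD[OF D_0_turns_N_indep]) (use A B C in \<open>auto simp: three E_def\<close>)
  moreover have "(\<Inter>i\<in>{..<3}. E i) =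
      {\<omega> \<in> space M. D 0 \<omega> = dir j \<and> N t \<omega> = n \<and> map (\<lambda>i. turn i \<omega>) [0..<n] = bs}"
    unfolding three by (auto simp: E_def)
  moreover have "(\<Prod>i<3. prob (E i)) = prob ?A * prob ?B * prob ?C"
    unfolding three by (simp add: E_def)
  ultimately show ?thesis
    using D_0_uniform[OF j] prob_turns[OF bs] prob_N[OF t] by simp
qed

text \<open>Given \<open>N t = n\<close>, the event is a finite disjoint union over a starting index
  and an admissible word of length n. Summing the word weights yields the survival probabilities,
  averaged over the uniform start.\<close>

lemma prob_N_walk_avoids:
  assumes t: "0 < t"
  shows "prob {\<omega> \<in> space M. N t \<omega> = n \<and> walk_avoids t \<omega>} =
    (rate * t) ^ n / fact n * exp (- (rate * t)) * ((\<Sum>j\<in>{0, 1, 2, 3}. survival p n j) / 4)"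
proof -
  let ?G = "\<lambda>(j, bs).
    {\<omega> \<in> space M. D 0 \<omega> = dir j \<and> N t \<omega> = n \<and> map (\<lambda>i. turn i \<omega>) [0..<n] = bs}"
  let ?w = "(rate * t) ^ n / fact n * exp (- (rate * t))"
  define L where "L = (\<lambda>j. {bs. length bs = n \<and> avoids j bs})"
  define I where "I = Sigma {0, 1, 2, 3 :: int} L"
  have [measurable]: "N t \<in> measurable M (count_space UNIV)" using N_measurable t by simp
  have finL: "finite (L j)" for j
    unfolding L_def by (rule finite_subset[OF _ finite_bool_lists_length[of n]]) auto
  have finI: "finite I" unfolding I_def using finL by (intro finite_SigmaI) auto
  have meas: "?G x \<in> sets M" for x
  proof -
    have eq: "map (\<lambda>i. turn i \<omega>) [0..<n] = bs \<longleftrightarrow> length bs = n \<and> (\<forall>i<n. turn i \<omega> = bs ! i)" for \<omega> bs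
      by (auto simp: list_eq_iff_nth_eq)
    show ?thesis unfolding eq by (cases x) simp
  qed
  have "{\<omega> \<in> space M. N t \<omega> = n \<and> walk_avoids t \<omega>} = (\<Union>x\<in>I. ?G x)"
    unfolding walk_avoids_def I_def L_def by auto
  also have "prob \<dots> = (\<Sum>x\<in>I. prob (?G x))"
  proof (rule finite_measure_finite_Union[OF finI])
    show "disjoint_family_on ?G I"
      unfolding disjoint_family_on_def I_def using inj_onD[OF dir_inj_on] by fastforce
  qed (use meas in blast)
  also have "\<dots> = (\<Sum>(j, bs)\<in>I. 1 / 4 * ?w * word_weight p bs)"
    using prob_D0_N_turns[OF t] by (intro sum.cong) (auto simp: I_def L_def)
  also have "\<dots> = (\<Sum>j\<in>{0, 1, 2, 3}. \<Sum>bs\<in>L j. 1 / 4 * ?w * word_weight p bs)"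
    unfolding I_def using finL by (subst sum.Sigma) auto
  also have "\<dots> = (\<Sum>j\<in>{0, 1, 2, 3}. 1 / 4 * ?w * survival p n j)"
    by (simp only: L_def sum_word_weight_avoids flip: sum_distrib_left)
  also have "\<dots> = ?w * ((\<Sum>j\<in>{0, 1, 2, 3}. survival p n j) / 4)"
    by (simp only: flip: sum_distrib_left) simp
  finally show ?thesis .
qed

lemma pred_walk_avoids:
  assumes "0 < t"
  shows "Measurable.pred M (walk_avoids t)"
proof -
  have [measurable]: "N t \<in> measurable M (count_space UNIV)" using N_measurable assms by simp
  have [measurable]: "Measurable.pred M (\<lambda>\<omega>. D 0 \<omega> = dir j)" for j
    unfolding pred_def by measurable
  have [measurable]: "(\<lambda>\<omega>. displacement (\<lambda>i. turn i \<omega>) k) \<in> measurable M (count_space UNIV)" for k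
    by (induction k) simp_all
  \<comment> \<open>Replacing the word of random length by a quantifier over k leaves only
    displacements at fixed k, which are measurable.\<close>
  have "walk_avoids t = (\<lambda>\<omega>. \<exists>j\<in>{0, 1, 2, 3}. D 0 \<omega> = dir j \<and>
      (\<forall>k. k \<le> N t \<omega> \<longrightarrow> (j + displacement (\<lambda>i. turn i \<omega>) k) mod 4 \<noteq> 3))"
    by (auto simp only: walk_avoids_def avoids_map_iff dir_eq_dir_3_iff fun_eq_iff)
  also have "Measurable.pred M \<dots>"
    by measurable
  finally show ?thesis .
qed

section \<open>Refining the grid and summing over the number of events\<close>

text \<open>For each m the two events agree on the good grid event, so their probabilities differ by
  at most the probability of a bad grid; letting m grow gives equality.\<close>

lemma prob_avoids_path_eq:
  assumes t: "0 < t"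
  shows "prob {\<omega> \<in> space M. \<forall>\<tau>\<in>{0..<t}. D \<tau> \<omega> \<noteq> dir 3} = prob {\<omega> \<in> space M. walk_avoids t \<omega>}"
    (is "prob ?E = prob ?F")
proof -
  have E: "?E \<in> events" and F: "?F \<in> events"
    using pred_avoids_path[of t] pred_walk_avoids[OF t] by (simp_all only: pred_def)
  have close: "\<bar>prob ?E - prob ?F\<bar> \<le> ((rate * t)\<^sup>2 + rate * t) / Suc m" for m
  proof -
    let ?B = "{\<omega> \<in> space M. \<not> good_grid t m \<omega>}"
    have B: "?B \<in> events"
      using pred_good_grid[OF t, of m] by measurable
    have "prob ?E \<le> prob (?F \<union> ?B)" "prob ?F \<le> prob (?E \<union> ?B)"
      using walk_avoids_iff[OF _ t, of _ m] by (intro finite_measure_mono sets.Un E F B; blast)+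
    moreover have "prob (?F \<union> ?B) \<le> prob ?F + prob ?B" "prob (?E \<union> ?B) \<le> prob ?E + prob ?B"
      by (intro measure_Un_le E F B)+
    ultimately show ?thesis using prob_not_good_grid[OF t, of m] by linarith
  qed
  have "(\<lambda>m. ((rate * t)\<^sup>2 + rate * t) / real (Suc m)) \<longlonglongrightarrow> 0"
    by (intro LIMSEQ_Suc lim_const_over_n)
  then have "\<bar>prob ?E - prob ?F\<bar> \<le> 0"
    by (rule LIMSEQ_le_const) (use close in blast)
  then show ?thesis by simp
qed

lemma prob_walk_avoids_sums:
  assumes t: "0 < t"
  shows "(\<lambda>n. (rate * t) ^ n / fact n * exp (- (rate * t)) *
      ((\<Sum>j\<in>{0, 1, 2, 3}. survival p n j) / 4)) sums prob {\<omega> \<in> space M. walk_avoids t \<omega>}"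
proof -
  have [measurable]: "N t \<in> measurable M (count_space UNIV)" using N_measurable t by simp
  note [measurable] = pred_walk_avoids[OF t]
  let ?G = "\<lambda>n. {\<omega> \<in> space M. N t \<omega> = n \<and> walk_avoids t \<omega>}"
  have "(\<lambda>n. prob (?G n)) sums prob (\<Union>n. ?G n)"
    by (rule finite_measure_UNION) (auto simp: disjoint_family_on_def)
  moreover have "(\<Union>n. ?G n) = {\<omega> \<in> space M. walk_avoids t \<omega>}" by auto
  ultimately show ?thesis by (simp only: prob_N_walk_avoids[OF t])
qed

end

theorem theorem11:
  fixes M :: "'a measure"
    and N :: "real \<Rightarrow> 'a \<Rightarrow> nat"
    and turn :: "nat \<Rightarrow> 'a \<Rightarrow> bool"
    and D :: "real \<Rightarrow> 'a \<Rightarrow> real \<times> real"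
    and X Y T :: "real \<Rightarrow> 'a \<Rightarrow> real"
    and lam c p t :: real
  assumes "0 < lam" and "0 < c" and "0 < p" and "p < 1"
    and "direction_process M N lam turn D p"
    and "\<And>t \<omega>. 0 \<le> t \<Longrightarrow> \<omega> \<in> space M \<Longrightarrow> (X t \<omega>, Y t \<omega>) = position c D t \<omega>"
    and "\<And>t \<omega>. 0 \<le> t \<Longrightarrow> \<omega> \<in> space M \<Longrightarrow> T t \<omega> = vertical_time D t \<omega>"
    and "0 < t"
  shows "\<P>(\<omega> in M. Y t \<omega> = c * T t \<omega>) =
    exp (- lam * t) / 8 *
      ((1 + 1 / sqrt (2 * p * (1 - p)))\<^sup>2 * exp (lam * t * sqrt (2 * p * (1 - p)))
       + (1 - 1 / sqrt (2 * p * (1 - p)))\<^sup>2 * exp (- lam * t * sqrt (2 * p * (1 - p)))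
       - (2 * p - 1)\<^sup>2 / (p * (1 - p)))"
proof -
  interpret direction_process M N lam turn D p by fact
  define s where "s = sqrt (2 * p * (1 - p))"
  have pq: "0 < p * (1 - p)" using assms by simp
  then have s: "s\<^sup>2 = 2 * p * (1 - p)" "s \<noteq> 0"
    using assms(3,4) by (simp_all add: s_def)
  have "Y t \<omega> = c * T t \<omega> \<longleftrightarrow> (\<forall>\<tau>\<in>{0..<t}. D \<tau> \<omega> \<noteq> dir 3)" if "\<omega> \<in> space M" for \<omega>
  proof -
    have "Y t \<omega> = snd (position c D t \<omega>)"
      using assms(6)[of t \<omega>] \<open>0 < t\<close> that by (metis less_imp_le snd_conv)
    then show ?thesis
      using snd_position_eq_iff[OF that \<open>0 < t\<close>, of c] assms(7)[of t \<omega>] \<open>0 < t\<close> \<open>0 < c\<close> that by simp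
  qed
  then have "\<P>(\<omega> in M. Y t \<omega> = c * T t \<omega>) = prob {\<omega> \<in> space M. \<forall>\<tau>\<in>{0..<t}. D \<tau> \<omega> \<noteq> dir 3}"
    by (intro arg_cong[where f = prob]) auto
  also have "\<dots> = exp (- (lam * t)) / 8 * ((1 + 1 / s)\<^sup>2 * exp (lam * t * s) +
      (1 - 1 / s)\<^sup>2 * exp (- (lam * t) * s) + (4 - 2 / s\<^sup>2))"
    unfolding prob_avoids_path_eq[OF \<open>0 < t\<close>]
    \<comment> \<open>Both facts sum the same series, so its two values coincide.\<close>
    using prob_walk_avoids_sums[OF \<open>0 < t\<close>] sums_poisson_survival[OF s, of "lam * t"]
    by (rule sums_unique2)
  \<comment> \<open>Uses 1 - 4p(1 - p) = (2p - 1)^2.\<close>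
  also have "4 - 2 / s\<^sup>2 = - ((2 * p - 1)\<^sup>2 / (p * (1 - p)))"
    unfolding s using pq assms(3,4) by (simp add: field_simps power2_eq_square)
  finally show ?thesis by (simp add: s_def)
qed

end
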